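(* Suppose $\theta=0$, $r=1$, and let $\{Z_n\}_{n\ge0}$ be a GW$^{\,\theta}$-process with parameters $(0,1,a_n,c_n)_{n\ge1}$. Then $\mathrm{P}(Z_n>0)=D_n$, so that $q=1-D$, where $D=\prod_{n\ge1}(1-c_n)^{A_{n-1}-A_n}\in[0,1]$. Furthermore, with $A=\lim_{n\to\infty}A_n\in[0,1)$: (i) if $A=0$ and $D=0$, then $q=1$ and $$\mathrm{P}(A_n\ln Z_n\le x|Z_n>0)\to1-e^{-x},\quad x\ge0;$$ (ii) if $A=0$ and $D>0$, then $q<1$ and $$\mathrm{P}(A_n\ln Z_n\le x)\to1-e^{-x}D,\quad x\ge0;$$ (iii) if $A\in(0,1)$ and $D=0$, then $q=1$ and $$\mathrm{E}(s^{Z_n}|Z_n>0)\to1-(1-s)^A,\quad 0\le s\le1;$$ (iv) if $A\in(0,1)$ and $D>0$, then $q<1$ and $Z_n$ converges almost surely to a random variable $Z_\infty$ such that $$\mathrm{E}(Z_\infty)=\infty,\quad \mathrm{E}(s^{Z_\infty})=1-(1-s)^AD,\quad 0\le s\le1.$$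
   Context: All limits are as $n\to\infty$. Let $\theta=0$, $r=1$, and let $(a_n,c_n)_{n\ge1}$ be real sequences with $0<a_n<1$, $0\le c_n<1$ for all $n\ge1$. Put $$f_n(s)=1-(1-c_n)^{1-a_n}(1-s)^{a_n},\quad 0\le s\le1.$$ Each $f_n(s)=\sum_{j\ge0}p_n(j)s^j$ is a probability generating function. The GW$^{\,\theta}$-process with parameters $(0,1,a_n,c_n)_{n\ge1}$ is the Galton-Watson process in a varying environment $\{Z_n\}_{n\ge0}$ with $Z_0=1$, $Z_n=\sum_{i=1}^{Z_{n-1}}X_{n,i}$, where $\{X_{n,i}\}_{n,i\ge1}$ are independent and $\mathrm{P}(X_{n,i}=j)=p_n(j)$. Thus $\mathrm{E}(s^{Z_n})=f_1\circ\cdots\circ f_n(s)$. The extinction probability is $q=\lim \mathrm{P}(Z_n=0)$. Notation: $A_0=1$, $A_n=\prod_{i=1}^n a_i$, $D_n=\prod_{i=1}^n(1-c_i)^{A_{i-1}-A_i}$, $A=\lim A_n$, $D=\lim D_n$ (both limits exist by monotonicity). Convention: $\ln 0=-\infty$. *)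

theory Defs
  imports "HOL-Probability.Probability"
begin

text \<open>
  A Galton-Watson process in a varying environment: for \<open>n, i \<ge> 1\<close>, \<open>X n i\<close> is the number of
  offspring of the \<open>i\<close>-th individual of generation \<open>n - 1\<close>, and \<open>p n\<close> is the offspring law of that
  generation. Values of \<open>p\<close> and \<open>X\<close> at index \<open>0\<close> are irrelevant.
\<close>

locale gw_varying_env = prob_space M for M :: "'w measure" +
  fixes p :: "nat \<Rightarrow> nat pmf"
    and X :: "nat \<Rightarrow> nat \<Rightarrow> 'w \<Rightarrow> nat"
    and Z :: "nat \<Rightarrow> 'w \<Rightarrow> nat"
  assumes indep_offspring:
      "indep_vars (\<lambda>_. count_space UNIV) (\<lambda>(n, i). X n i) ({1..} \<times> {1..})"
    and offspring_law:
      "\<And>n i j. n \<ge> 1 \<Longrightarrow> i \<ge> 1 \<Longrightarrow> prob {\<omega> \<in> space M. X n i \<omega> = j} = pmf (p n) j"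
    and initial: "\<And>\<omega>. \<omega> \<in> space M \<Longrightarrow> Z 0 \<omega> = 1"
    and branching:
      "\<And>n \<omega>. n \<ge> 1 \<Longrightarrow> \<omega> \<in> space M \<Longrightarrow> Z n \<omega> = (\<Sum>i = 1..Z (n - 1) \<omega>. X n i \<omega>)"

definition has_pgf :: "nat pmf \<Rightarrow> (real \<Rightarrow> real) \<Rightarrow> bool" where
  "has_pgf p f \<longleftrightarrow> (\<forall>s\<in>{0..1}. (\<lambda>j. pmf p j * s ^ j) sums f s)"

text \<open>
  The power with base \<open>1 - s\<close> takes the correct value \<open>0\<close> at \<open>s = 1\<close>, since
  \<open>0 powr x = 0\<close>; the base \<open>1 - c\<close> is positive for \<open>0 \<le> c < 1\<close>.
\<close>

definition theta0_pgf :: "real \<Rightarrow> real \<Rightarrow> real \<Rightarrow> real" where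
  "theta0_pgf a c s = 1 - (1 - c) powr (1 - a) * (1 - s) powr a"

text \<open>The Galton-Watson process with theta equal to \<open>0\<close> and parameters \<open>(0, 1, a n, c n)\<close>, \<open>n \<ge> 1\<close>.\<close>

locale gw_theta0 = gw_varying_env M p X Z
  for M :: "'w measure" and p X Z +
  fixes a c :: "nat \<Rightarrow> real"
  assumes a_range: "\<And>n. n \<ge> 1 \<Longrightarrow> 0 < a n \<and> a n < 1"
    and c_range: "\<And>n. n \<ge> 1 \<Longrightarrow> 0 \<le> c n \<and> c n < 1"
    and offspring_pgf: "\<And>n. n \<ge> 1 \<Longrightarrow> has_pgf (p n) (theta0_pgf (a n) (c n))"

definition A_seq :: "(nat \<Rightarrow> real) \<Rightarrow> nat \<Rightarrow> real" where
  "A_seq a n = (\<Prod>i = 1..n. a i)"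

definition D_seq :: "(nat \<Rightarrow> real) \<Rightarrow> (nat \<Rightarrow> real) \<Rightarrow> nat \<Rightarrow> real" where
  "D_seq a c n = (\<Prod>i = 1..n. (1 - c i) powr (A_seq a (i - 1) - A_seq a i))"

definition A_lim :: "(nat \<Rightarrow> real) \<Rightarrow> real" where
  "A_lim a = lim (A_seq a)"

text \<open>
  The infinite product may be \<open>0\<close> with all factors positive. In that case it diverges in the sense
  of \<^const>\<open>convergent_prod\<close>, so it is taken as the limit of the partial products.
\<close>

definition D_lim :: "(nat \<Rightarrow> real) \<Rightarrow> (nat \<Rightarrow> real) \<Rightarrow> real" where
  "D_lim a c = lim (D_seq a c)"

definition extinction_prob :: "'w measure \<Rightarrow> (nat \<Rightarrow> 'w \<Rightarrow> nat) \<Rightarrow> real" where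
  "extinction_prob M Z = lim (\<lambda>n. \<P>(\<omega> in M. Z n \<omega> = 0))"

text \<open>The logarithm with \<open>ln 0 = -\<infinity>\<close> (the library's real logarithm has \<open>ln 0 = 0\<close>).\<close>

definition eln :: "nat \<Rightarrow> ereal" where
  "eln k = (if k = 0 then -\<infinity> else ereal (ln (real k)))"

definition cond_expectation_on :: "'w measure \<Rightarrow> ('w \<Rightarrow> real) \<Rightarrow> ('w \<Rightarrow> bool) \<Rightarrow> real" where
  "cond_expectation_on M Y Q = (\<integral>\<omega>. Y \<omega> \<partial>uniform_measure M {\<omega> \<in> space M. Q \<omega>})"

end

theory Submission
  imports Defs "HOL-Real_Asymp.Real_Asymp"
begin

text \<open>
  The functions \<open>f n\<close> compose explicitly: \<open>E (s ^ Z n) = 1 - D n * (1 - s) powr A n\<close>. Taking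
  \<open>s = 0\<close> gives the survival probability. When \<open>A n\<close> tends to \<open>0\<close>, the choice
  \<open>s = 1 - exp (- y / A n)\<close> makes \<open>s ^ Z n\<close> asymptotically the indicator of
  \<open>A n * ln (Z n) \<le> y\<close>, while \<open>(1 - s) powr A n = exp (- y)\<close>. When the limits of \<open>A n\<close> and
  \<open>D n\<close> are positive, the probabilities \<open>P (X n i \<noteq> 1)\<close> are summable over \<open>n\<close> for each \<open>i\<close>, so by
  Borel-Cantelli \<open>Z\<close> almost surely becomes constant or tends to infinity. The latter has
  probability \<open>0\<close> because the limit of the generating functions is continuous at \<open>s = 1\<close>.
\<close>

section \<open>Expectations of bounded functions of integer-valued variables\<close>

lemma powr_tendsto_0_at_right:
  fixes e :: real
  assumes "e > 0"
  shows "((\<lambda>t. t powr e) \<longlongrightarrow> 0) (at_right 0)"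
  using assms by real_asymp

lemma (in prob_space) integrable_indicator_event [simp]:
  "S \<in> events \<Longrightarrow> integrable M (indicator S :: 'a \<Rightarrow> real)"
  by (rule integrable_real_indicator) (simp_all add: less_top[symmetric])

text \<open>This is conditioning on a discrete variable in elementary form: the partial sums
  integrate \<open>f\<close> over \<open>N < n\<close>, and boundedness of \<open>f\<close> allows
  dominated convergence.\<close>

lemma (in prob_space) integral_fibres_sums:
  fixes f :: "'a \<Rightarrow> real" and N :: "'a \<Rightarrow> nat"
  assumes [measurable]: "f \<in> borel_measurable M" "N \<in> measurable M (count_space UNIV)"
    and bound: "\<And>\<omega>. \<omega> \<in> space M \<Longrightarrow> \<bar>f \<omega>\<bar> \<le> B"
  shows "(\<lambda>k. \<integral>\<omega>. f \<omega> * indicator {k} (N \<omega>) \<partial>M) sums (\<integral>\<omega>. f \<omega> \<partial>M)"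
proof -
  have "0 \<le> B"
    using not_empty bound by (blast intro: order_trans[OF abs_ge_zero])
  have int: "integrable M (\<lambda>\<omega>. f \<omega> * indicator {k} (N \<omega>))" for k
    by (intro integrable_const_bound[where B=B])
      (use bound \<open>0 \<le> B\<close> in \<open>auto simp: indicator_def intro!: AE_I2\<close>)
  have partial: "(\<Sum>k<n. f \<omega> * indicator {k} (N \<omega>)) = f \<omega> * indicator {..<n} (N \<omega>)" for n \<omega>
    by (auto simp: indicator_def simp flip: sum_distrib_left)
  have "(\<lambda>n. \<integral>\<omega>. f \<omega> * indicator {..<n} (N \<omega>) \<partial>M) \<longlonglongrightarrow> (\<integral>\<omega>. f \<omega> \<partial>M)"
  proof (rule integral_dominated_convergence[where w="\<lambda>_. B"])
    have "(\<lambda>n. f \<omega> * indicator {..<n} (N \<omega>)) \<longlonglongrightarrow> f \<omega>" for \<omega>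
      by (rule tendsto_eventually)
        (use eventually_gt_at_top[of "N \<omega>"] in eventually_elim, auto)
    then show "AE \<omega> in M. (\<lambda>n. f \<omega> * indicator {..<n} (N \<omega>)) \<longlonglongrightarrow> f \<omega>"
      by simp
    show "AE \<omega> in M. norm (f \<omega> * indicator {..<n} (N \<omega>)) \<le> B" for n
      using bound \<open>0 \<le> B\<close> by (auto simp: indicator_def intro!: AE_I2)
    show "(\<lambda>\<omega>. f \<omega> * indicator {..<n} (N \<omega>)) \<in> borel_measurable M" for n
      by (intro borel_measurable_times measurable_compose[OF assms(2)]) auto
  qed auto
  then show ?thesis
    using int by (simp add: sums_def Bochner_Integration.integral_sum flip: partial
        del: sum_mult_indicator)
qed

lemma (in prob_space) pgf_sums:
  fixes N :: "'a \<Rightarrow> nat"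
  assumes [measurable]: "N \<in> measurable M (count_space UNIV)" and s: "0 \<le> s" "s \<le> (1::real)"
  shows "(\<lambda>k. prob {\<omega> \<in> space M. N \<omega> = k} * s ^ k) sums (\<integral>\<omega>. s ^ N \<omega> \<partial>M)"
proof -
  have "(\<lambda>k. \<integral>\<omega>. s ^ N \<omega> * indicator {k} (N \<omega>) \<partial>M) sums (\<integral>\<omega>. s ^ N \<omega> \<partial>M)"
    by (rule integral_fibres_sums[where B=1]) (use s in \<open>auto intro: power_le_one\<close>)
  moreover have "(\<integral>\<omega>. s ^ N \<omega> * indicator {k} (N \<omega>) \<partial>M) = prob {\<omega> \<in> space M. N \<omega> = k} * s ^ k" for k
  proof -
    have "(\<integral>\<omega>. s ^ N \<omega> * indicator {k} (N \<omega>) \<partial>M) = (\<integral>\<omega>. s ^ k * indicator {\<omega> \<in> space M. N \<omega> = k} \<omega> \<partial>M)"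
      by (intro Bochner_Integration.integral_cong) (auto simp: indicator_def)
    then show ?thesis by simp
  qed
  ultimately show ?thesis by simp
qed

lemma (in prob_space) integral_uniform_measure_real:
  fixes f :: "'a \<Rightarrow> real"
  assumes [measurable]: "f \<in> borel_measurable M" "S \<in> events" and "prob S > 0"
  shows "(\<integral>\<omega>. f \<omega> \<partial>uniform_measure M S) = (\<integral>\<omega>. f \<omega> * indicator S \<omega> \<partial>M) / prob S"
proof -
  \<comment> \<open>The density is a quotient in \<open>ennreal\<close>;
    \<open>integral_density\<close> wants it as the image of a real function. Positivity of
    \<open>prob S\<close> rules out division by zero.\<close>
  have "(\<lambda>\<omega>. indicator S \<omega> / emeasure M S) = (\<lambda>\<omega>. ennreal (indicator S \<omega> / prob S))"
    using assms(3) by (intro ext) (simp add: emeasure_eq_measure divide_ennreal ennreal_1[symmetric]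
        split: split_indicator del: ennreal_1)
  then have "(\<integral>\<omega>. f \<omega> \<partial>uniform_measure M S) = (\<integral>\<omega>. (indicator S \<omega> / prob S) *\<^sub>R f \<omega> \<partial>M)"
    unfolding uniform_measure_def by (simp add: integral_density)
  also have "\<dots> = (\<integral>\<omega>. f \<omega> * indicator S \<omega> / prob S \<partial>M)"
    by (simp add: mult.commute)
  finally show ?thesis by simp
qed

text \<open>On the naturals the Borel sets are all sets, so the result for Borel functions carries
  over.\<close>

lemma measurable_count_space_sum:
  fixes f :: "'i \<Rightarrow> 'b \<Rightarrow> nat"
  assumes "\<And>i. i \<in> I \<Longrightarrow> f i \<in> measurable N (count_space UNIV)"
  shows "(\<lambda>x. \<Sum>i\<in>I. f i x) \<in> measurable N (count_space UNIV)"
proof -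
  have eq: "measurable N (count_space UNIV :: nat measure) = borel_measurable N"
    by (rule measurable_cong_sets) (simp_all add: sets_borel_eq_count_space)
  show ?thesis using assms unfolding eq by (rule borel_measurable_sum)
qed

section \<open>Measurability and the one-generation recursion for generating functions\<close>

context gw_varying_env
begin

text \<open>Writing \<open>Z n\<close> as a deterministic function of the offspring array makes it
  visible that it depends on generations 1 to n only, so independence of disjoint index blocks can
  be applied.\<close>

fun size_fun :: "nat \<Rightarrow> (nat \<times> nat \<Rightarrow> nat) \<Rightarrow> nat" where
  "size_fun 0 x = 1"
| "size_fun (Suc n) x = (\<Sum>i = 1..size_fun n x. x (Suc n, i))"

lemma size_fun_cong:
  assumes "\<And>m i. m \<in> {1..n} \<Longrightarrow> i \<ge> 1 \<Longrightarrow> x (m, i) = y (m, i)"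
  shows "size_fun n x = size_fun n y"
  using assms
proof (induction n)
  case (Suc n)
  have "size_fun n x = size_fun n y" by (rule Suc.IH) (simp add: Suc.prems)
  then show ?case by (simp add: Suc.prems)
qed simp

lemma measurable_size_fun:
  "size_fun n \<in> measurable (PiM ({1..n} \<times> {1..}) (\<lambda>_. count_space UNIV)) (count_space UNIV)"
proof -
  \<comment> \<open>The product space stays the one for n while the induction runs over m.\<close>
  have "size_fun m \<in> measurable (PiM ({1..n} \<times> {1..}) (\<lambda>_. count_space UNIV)) (count_space UNIV)"
    if "m \<le> n" for m
    using that
  proof (induction m)
    case (Suc m)
    then have g: "size_fun m \<in> measurable (PiM ({1..n} \<times> {1..}) (\<lambda>_. count_space UNIV)) (count_space UNIV)"
      by simp
    \<comment> \<open>The number of summands varies with x; it is first frozen at k, and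
      \<open>measurable_compose_countable\<close> then glues the countably many cases.\<close>
    have "(\<lambda>x. \<Sum>i = 1..k. x (Suc m, i)) \<in>
        measurable (PiM ({1..n} \<times> {1..}) (\<lambda>_. count_space (UNIV::nat set))) (count_space UNIV)" for k :: nat
      by (intro measurable_count_space_sum measurable_component_singleton) (use Suc.prems in auto)
    from measurable_compose_countable[OF this g] show ?case
      by simp
  qed (simp add: fun_eq_iff[of "size_fun 0" "\<lambda>_. 1", THEN iffD2])
  then show ?thesis by simp
qed

lemma Z_eq_size_fun:
  assumes "\<omega> \<in> space M"
  shows "Z n \<omega> = size_fun n (\<lambda>(m, i). X m i \<omega>)"
  using assms by (induction n) (auto simp: initial branching)

lemma measurable_X [measurable]:
  assumes "n \<ge> 1" "i \<ge> 1"
  shows "X n i \<in> measurable M (count_space UNIV)"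
  using indep_offspring assms unfolding indep_vars_def by force

lemma measurable_Z [measurable]: "Z n \<in> measurable M (count_space UNIV)"
proof (induction n)
  case 0
  then show ?case by (subst measurable_cong[OF initial]) auto
next
  case (Suc n)
  have "(\<lambda>\<omega>. \<Sum>i = 1..k. X (Suc n) i \<omega>) \<in> measurable M (count_space UNIV)" for k :: nat
    by (intro measurable_count_space_sum measurable_X) auto
  from measurable_compose_countable[OF this Suc] show ?case
    by (subst measurable_cong[OF branching]) auto
qed

lemma offspring_pgf_integral:
  assumes "n \<ge> 1" "i \<ge> 1" "has_pgf (p n) f" "0 \<le> s" "s \<le> 1"
  shows "(\<integral>\<omega>. s ^ X n i \<omega> \<partial>M) = f s"
proof (rule sums_unique2)
  show "(\<lambda>j. pmf (p n) j * s ^ j) sums (\<integral>\<omega>. s ^ X n i \<omega> \<partial>M)"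
    using pgf_sums[OF measurable_X[OF assms(1,2)] assms(4,5)] assms(1,2) by (simp add: offspring_law)
  show "(\<lambda>j. pmf (p n) j * s ^ j) sums f s"
    using assms unfolding has_pgf_def by auto
qed

text \<open>Split over the value k of \<open>Z n\<close>. On that event \<open>Z (Suc n)\<close> is
  a sum of k fresh offspring counts, independent of the past and of each other, so the event
  contributes its probability times \<open>f s ^ k\<close>.\<close>

lemma pgf_branching:
  assumes f: "has_pgf (p (Suc n)) f" and s: "0 \<le> s" "s \<le> 1" and fs: "0 \<le> f s" "f s \<le> 1"
  shows "(\<integral>\<omega>. s ^ Z (Suc n) \<omega> \<partial>M) = (\<integral>\<omega>. f s ^ Z n \<omega> \<partial>M)"
proof (rule sums_unique2)
  show "(\<lambda>k. prob {\<omega> \<in> space M. Z n \<omega> = k} * f s ^ k) sums (\<integral>\<omega>. f s ^ Z n \<omega> \<partial>M)"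
    by (rule pgf_sums) (use fs in auto)
  have "(\<integral>\<omega>. s ^ Z (Suc n) \<omega> * indicator {k} (Z n \<omega>) \<partial>M) = prob {\<omega> \<in> space M. Z n \<omega> = k} * f s ^ k" for k
  proof -
    \<comment> \<open>\<open>past\<close> contains all individuals that could exist up to generation
      n, \<open>new\<close> the first k of the next one. The blocks are disjoint, hence the
      functions g and h of them are independent.\<close>
    define past new where "past = {1..n} \<times> {1::nat..}" and "new = Pair (Suc n) ` {1..k}"
    have sub: "past \<inter> new = {}" "past \<subseteq> {1..} \<times> {1..}" "new \<subseteq> {1..} \<times> {1..}" "finite new"
      by (auto simp: past_def new_def)
    define g where "g = (\<lambda>x. indicator {k} (size_fun n x) :: real)"
    define h where "h = (\<lambda>x. \<Prod>j\<in>new. s ^ x j)"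
    have g_meas: "g \<in> borel_measurable (PiM past (\<lambda>_. count_space UNIV))"
      unfolding g_def past_def
      by (rule measurable_compose[OF measurable_size_fun]) simp
    have h_meas: "h \<in> borel_measurable (PiM new (\<lambda>_. count_space UNIV))"
      unfolding h_def
      by (intro borel_measurable_prod measurable_compose[OF measurable_component_singleton]) auto
    have X_meas: "(\<lambda>\<omega>. X (fst j) (snd j) \<omega>) \<in> measurable M (count_space UNIV)" if "j \<in> new" for j
      using that sub(3) by (intro measurable_X) auto
    let ?G = "\<lambda>\<omega>. g (restrict (\<lambda>j. (\<lambda>(n, i). X n i) j \<omega>) past)"
    let ?H = "\<lambda>\<omega>. h (restrict (\<lambda>j. (\<lambda>(n, i). X n i) j \<omega>) new)"
    have G: "?G \<omega> = indicator {k} (Z n \<omega>)" if "\<omega> \<in> space M" for \<omega>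
      unfolding g_def Z_eq_size_fun[OF that]
      by (rule arg_cong[where f="indicator {k}"], rule size_fun_cong) (auto simp: past_def)
    have H: "?H \<omega> = (\<Prod>j\<in>new. s ^ X (fst j) (snd j) \<omega>)" for \<omega>
      unfolding h_def by (intro prod.cong) (auto simp: split_beta)
    have H': "(\<Prod>j\<in>new. s ^ X (fst j) (snd j) \<omega>) = s ^ (\<Sum>i = 1..k. X (Suc n) i \<omega>)" for \<omega>
      unfolding new_def by (subst prod.reindex) (auto simp: inj_on_def power_sum)
    have indep: "indep_var borel ?G borel ?H"
      using indep_var_compose[OF indep_var_restrict[OF indep_offspring sub(1-3)] g_meas h_meas]
      by (simp add: comp_def)
    \<comment> \<open>Where \<open>Z n\<close> equals k the random summation limit becomes k;
      elsewhere both integrands vanish.\<close>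
    have "(\<integral>\<omega>. s ^ Z (Suc n) \<omega> * indicator {k} (Z n \<omega>) \<partial>M) = (\<integral>\<omega>. ?G \<omega> * ?H \<omega> \<partial>M)"
      by (intro Bochner_Integration.integral_cong) (simp_all only: G H H', auto simp: branching indicator_def)
    also have "\<dots> = (\<integral>\<omega>. ?G \<omega> \<partial>M) * (\<integral>\<omega>. ?H \<omega> \<partial>M)"
    proof (rule indep_var_lebesgue_integral[OF indep])
      show "integrable M ?G" "integrable M ?H"
        using indep_var_rv1[OF indep] indep_var_rv2[OF indep] s
        by (auto intro!: integrable_const_bound[where B=1] AE_I2 simp: g_def h_def abs_prod
            intro!: prod_le_1 power_le_one)
    qed
    also have "(\<integral>\<omega>. ?G \<omega> \<partial>M) = (\<integral>\<omega>. indicator {\<omega> \<in> space M. Z n \<omega> = k} \<omega> \<partial>M)"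
      by (intro Bochner_Integration.integral_cong) (simp_all only: G, auto simp: indicator_def)
    also have "\<dots> = prob {\<omega> \<in> space M. Z n \<omega> = k}" by simp
    \<comment> \<open>Second use of independence, now among the k individuals of the new
      generation.\<close>
    also have "(\<integral>\<omega>. ?H \<omega> \<partial>M) = (\<Prod>j\<in>new. \<integral>\<omega>. s ^ X (fst j) (snd j) \<omega> \<partial>M)"
      unfolding H
    proof (rule indep_vars_lebesgue_integral)
      have "indep_vars (\<lambda>_. count_space UNIV) (\<lambda>(n, i). X n i) new"
        by (rule indep_vars_subset[OF indep_offspring sub(3)])
      from indep_vars_compose2[OF this, of "\<lambda>_ m. s ^ m" "\<lambda>_. borel"]
      show "indep_vars (\<lambda>_. borel) (\<lambda>j \<omega>. s ^ X (fst j) (snd j) \<omega>) new"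
        by (simp add: split_beta)
      fix j assume "j \<in> new"
      note [measurable] = X_meas[OF this]
      show "integrable M (\<lambda>\<omega>. s ^ X (fst j) (snd j) \<omega>)"
        by (intro integrable_const_bound[where B=1]) (use s in \<open>auto intro: power_le_one\<close>)
    qed (fact sub(4))
    also have "\<dots> = (\<Prod>j\<in>new. f s)"
      using s f by (intro prod.cong) (auto simp: new_def offspring_pgf_integral)
    also have "\<dots> = f s ^ k"
      by (simp add: new_def card_image inj_on_def)
    finally show ?thesis .
  qed
  moreover have "(\<lambda>k. \<integral>\<omega>. s ^ Z (Suc n) \<omega> * indicator {k} (Z n \<omega>) \<partial>M) sums (\<integral>\<omega>. s ^ Z (Suc n) \<omega> \<partial>M)"
    by (rule integral_fibres_sums[where B=1]) (use s in \<open>auto intro: power_le_one\<close>)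
  ultimately show "(\<lambda>k. prob {\<omega> \<in> space M. Z n \<omega> = k} * f s ^ k) sums (\<integral>\<omega>. s ^ Z (Suc n) \<omega> \<partial>M)"
    by simp
qed

end

section \<open>Explicit generating functions and survival probabilities\<close>

context gw_theta0
begin

abbreviation "A \<equiv> A_seq a"
abbreviation "D \<equiv> D_seq a c"

lemma A_0 [simp]: "A 0 = 1" and A_Suc: "A (Suc n) = A n * a (Suc n)"
  by (simp_all add: A_seq_def)

lemma D_0 [simp]: "D 0 = 1"
  and D_Suc: "D (Suc n) = D n * (1 - c (Suc n)) powr (A n - A (Suc n))"
  by (simp_all add: D_seq_def)

lemma a_bounds: "0 < a (Suc n)" "a (Suc n) < 1"
  using a_range[of "Suc n"] by auto

lemma c_bounds: "0 \<le> c (Suc n)" "c (Suc n) < 1"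
  using c_range[of "Suc n"] by auto

lemma A_pos: "0 < A n"
  by (induction n) (auto simp: A_Suc a_bounds)

lemma A_Suc_le: "A (Suc n) \<le> A n"
  using A_pos[of n] a_bounds[of n] by (simp add: A_Suc mult_le_cancel_left2)

lemma decseq_A: "decseq A"
  by (rule decseq_SucI) (rule A_Suc_le)

lemma D_pos: "0 < D n"
  by (induction n) (use c_bounds in \<open>auto simp: D_Suc less_le\<close>)

lemma D_Suc_le: "D (Suc n) \<le> D n"
proof -
  have "(1 - c (Suc n)) powr (A n - A (Suc n)) \<le> 1"
    using c_bounds[of n] A_Suc_le[of n] by (intro powr_le1) auto
  then show ?thesis
    using D_pos[of n] by (simp add: D_Suc mult_le_cancel_left2)
qed

lemma decseq_D: "decseq D"
  by (rule decseq_SucI) (rule D_Suc_le)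

lemma A_tendsto: "A \<longlonglongrightarrow> A_lim a"
  unfolding A_lim_def
  using decseq_convergent[OF decseq_A, of 0] A_pos
  by (metis limI less_imp_le)

lemma D_tendsto: "D \<longlonglongrightarrow> D_lim a c"
  unfolding D_lim_def
  using decseq_convergent[OF decseq_D, of 0] D_pos
  by (metis limI less_imp_le)

lemma A_lim_le: "A_lim a \<le> A n"
  using decseq_ge[OF decseq_A A_tendsto] .

lemma D_lim_le: "D_lim a c \<le> D n"
  using decseq_ge[OF decseq_D D_tendsto] .

lemma A_lim_nonneg: "0 \<le> A_lim a"
  by (rule LIMSEQ_le_const[OF A_tendsto]) (use A_pos in \<open>auto intro: less_imp_le\<close>)

lemma D_lim_nonneg: "0 \<le> D_lim a c"
  by (rule LIMSEQ_le_const[OF D_tendsto]) (use D_pos in \<open>auto intro: less_imp_le\<close>)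

lemma A_lim_less_1: "A_lim a < 1"
  using A_lim_le[of 1] a_bounds[of 0] A_Suc[of 0] by simp

lemma theta0_pgf_bounds:
  assumes "0 \<le> s" "s \<le> 1"
  shows "0 \<le> theta0_pgf (a (Suc n)) (c (Suc n)) s" "theta0_pgf (a (Suc n)) (c (Suc n)) s \<le> 1"
proof -
  have "(1 - c (Suc n)) powr (1 - a (Suc n)) \<le> 1" "(1 - s) powr a (Suc n) \<le> 1"
    using assms a_bounds[of n] c_bounds[of n] by (auto intro!: powr_le1)
  then show "0 \<le> theta0_pgf (a (Suc n)) (c (Suc n)) s"
    unfolding theta0_pgf_def by (simp add: mult_le_one)
qed (simp add: theta0_pgf_def)

text \<open>The last generation is peeled off, so the induction hypothesis is applied at
  \<open>?f s\<close> and s must be arbitrary. Raising \<open>1 - ?f s\<close> to the power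
  \<open>A n\<close> gives the exponents \<open>(1 - a (Suc n)) * A n = A n - A (Suc n)\<close> and
  \<open>a (Suc n) * A n = A (Suc n)\<close>.\<close>

lemma pgf_Z:
  assumes "0 \<le> s" "s \<le> 1"
  shows "(\<integral>\<omega>. s ^ Z n \<omega> \<partial>M) = 1 - D n * (1 - s) powr A n"
  using assms
proof (induction n arbitrary: s)
  case 0
  have "(\<integral>\<omega>. s ^ Z 0 \<omega> \<partial>M) = (\<integral>\<omega>. s \<partial>M)"
    by (intro Bochner_Integration.integral_cong) (auto simp: initial)
  then show ?case using 0 by (simp add: prob_space)
next
  case (Suc n)
  let ?f = "theta0_pgf (a (Suc n)) (c (Suc n))"
  note bounds = theta0_pgf_bounds[OF Suc.prems, of n]
  have "(\<integral>\<omega>. s ^ Z (Suc n) \<omega> \<partial>M) = (\<integral>\<omega>. ?f s ^ Z n \<omega> \<partial>M)"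
    by (rule pgf_branching[OF offspring_pgf]) (use Suc.prems bounds in auto)
  also have "\<dots> = 1 - D n * (1 - ?f s) powr A n"
    by (rule Suc.IH) (fact bounds)+
  also have "(1 - ?f s) powr A n
      = (1 - c (Suc n)) powr (A n - A (Suc n)) * (1 - s) powr A (Suc n)"
    using Suc.prems c_bounds[of n]
    by (simp add: theta0_pgf_def powr_mult powr_powr A_Suc algebra_simps)
  finally show ?case by (simp add: D_Suc mult.assoc)
qed

lemma prob_Z_eq_0: "\<P>(\<omega> in M. Z n \<omega> = 0) = 1 - D n"
proof -
  have "\<P>(\<omega> in M. Z n \<omega> = 0) = (\<integral>\<omega>. indicator {\<omega> \<in> space M. Z n \<omega> = 0} \<omega> \<partial>M)"
    by simp
  \<comment> \<open>Since \<open>0 ^ 0 = 1\<close>, the variable \<open>0 ^ Z n\<close> is the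
    indicator of extinction.\<close>
  also have "\<dots> = (\<integral>\<omega>. 0 ^ Z n \<omega> \<partial>M)"
    by (intro Bochner_Integration.integral_cong) (auto simp: indicator_def power_0_left)
  also have "\<dots> = 1 - D n" using pgf_Z[of 0 n] by simp
  finally show ?thesis .
qed

lemma prob_Z_pos: "\<P>(\<omega> in M. Z n \<omega> > 0) = D n"
  using prob_neg[of "\<lambda>\<omega>. Z n \<omega> = 0"] by (simp add: prob_Z_eq_0)

lemma integrable_power_Z [simp]:
  fixes s :: real
  assumes "0 \<le> s" "s \<le> 1"
  shows "integrable M (\<lambda>\<omega>. s ^ Z n \<omega>)"
  by (intro integrable_const_bound[where B=1]) (use assms in \<open>auto intro: power_le_one\<close>)

text \<open>On extinction \<open>s ^ Z n\<close> equals 1, even for s = 0, so removing that event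
  subtracts its probability.\<close>

lemma pgf_Z_survival:
  assumes "0 \<le> s" "s \<le> 1"
  shows "(\<integral>\<omega>. s ^ Z n \<omega> * indicator {\<omega> \<in> space M. Z n \<omega> > 0} \<omega> \<partial>M)
    = D n * (1 - (1 - s) powr A n)"
proof -
  have "(\<integral>\<omega>. s ^ Z n \<omega> * indicator {\<omega> \<in> space M. Z n \<omega> > 0} \<omega> \<partial>M)
      = (\<integral>\<omega>. s ^ Z n \<omega> - indicator {\<omega> \<in> space M. Z n \<omega> = 0} \<omega> \<partial>M)"
    by (intro Bochner_Integration.integral_cong) (auto simp: indicator_def)
  also have "\<dots> = (1 - D n * (1 - s) powr A n) - (1 - D n)"
    using assms by (subst Bochner_Integration.integral_diff) (auto simp: pgf_Z prob_Z_eq_0)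
  finally show ?thesis by (simp add: algebra_simps)
qed

lemma extinction_tendsto: "(\<lambda>n. \<P>(\<omega> in M. Z n \<omega> = 0)) \<longlonglongrightarrow> 1 - D_lim a c"
  unfolding prob_Z_eq_0 by (intro tendsto_intros D_tendsto)

lemma extinction_prob_eq: "extinction_prob M Z = 1 - D_lim a c"
  unfolding extinction_prob_def by (rule limI[OF extinction_tendsto])

text \<open>The factor \<open>D n\<close> cancels, so the conditional generating function depends on
  \<open>A n\<close> alone. This is why conditional limits exist even when \<open>D n\<close> tends
  to 0.\<close>

lemma cond_pgf_Z:
  assumes "0 \<le> s" "s \<le> 1"
  shows "cond_expectation_on M (\<lambda>\<omega>. s ^ Z n \<omega>) (\<lambda>\<omega>. Z n \<omega> > 0) = 1 - (1 - s) powr A n"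
  unfolding cond_expectation_on_def using D_pos[of n]
  by (subst integral_uniform_measure_real) (simp_all add: prob_Z_pos pgf_Z_survival assms)

section \<open>Limit laws on the logarithmic scale when \<open>A n\<close> tends to 0\<close>

abbreviation log_cdf :: "nat \<Rightarrow> real \<Rightarrow> real" where
  "log_cdf n x \<equiv> \<P>(\<omega> in M. ereal (A n) * eln (Z n \<omega>) \<le> ereal x \<bar> Z n \<omega> > 0)"

lemma log_le_iff:
  assumes "k > 0"
  shows "ereal (A n) * eln k \<le> ereal x \<longleftrightarrow> real k \<le> exp (x / A n)"
proof -
  have "ereal (A n) * eln k \<le> ereal x \<longleftrightarrow> ln (real k) \<le> x / A n"
    using assms A_pos[of n] by (simp add: eln_def field_simps)
  also have "\<dots> \<longleftrightarrow> real k \<le> exp (x / A n)"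
    using assms by (metis exp_le_cancel_iff exp_ln of_nat_0_less_iff)
  finally show ?thesis .
qed

lemma log_cdf_eq:
  "log_cdf n x = prob {\<omega> \<in> space M. real (Z n \<omega>) \<le> exp (x / A n) \<and> Z n \<omega> > 0} / D n"
  unfolding cond_prob_def prob_Z_pos
  by (intro arg_cong2[where f="(/)"] arg_cong[where f=prob] refl) (auto simp: log_le_iff)

text \<open>Both bounds come from \<open>s = 1 - exp (- y / A n)\<close>, for which \<open>(1 - s) powr A n = exp (- y)\<close>.\<close>

lemma log_cdf_upper:
  assumes "0 \<le> x" "x < y"
  shows "log_cdf n x * (1 - exp (- ((y - x) / A n))) \<le> 1 - exp (- y)"
proof -
  define s where "s = 1 - exp (- (y / A n))"
  have s: "0 \<le> s" "s \<le> 1" and pow: "(1 - s) powr A n = exp (- y)"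
    using A_pos[of n] assms by (auto simp: s_def powr_def)
  let ?S = "{\<omega> \<in> space M. real (Z n \<omega>) \<le> exp (x / A n) \<and> Z n \<omega> > 0}"
  let ?b = "1 - exp (- ((y - x) / A n))"
  have "prob ?S * ?b = (\<integral>\<omega>. ?b * indicator ?S \<omega> \<partial>M)" by simp
  also have "\<dots> \<le> (\<integral>\<omega>. s ^ Z n \<omega> * indicator {\<omega> \<in> space M. Z n \<omega> > 0} \<omega> \<partial>M)"
  proof (rule integral_mono)
    fix \<omega>
    \<comment> \<open>Bernoulli's inequality gives \<open>s ^ Z n\<close> at least
      \<open>1 - Z n * (1 - s)\<close>, and below the threshold \<open>Z n * (1 - s)\<close> is at
      most \<open>exp ((x - y) / A n)\<close>.\<close>
    have "?b \<le> s ^ Z n \<omega>" if "real (Z n \<omega>) \<le> exp (x / A n)"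
    proof -
      have "?b = 1 - exp (x / A n) * (1 - s)"
        by (simp add: s_def diff_divide_distrib flip: exp_add)
      also have "\<dots> \<le> 1 + real (Z n \<omega>) * (s - 1)"
        using mult_right_mono[OF that, of "1 - s"] s by (simp add: algebra_simps)
      also have "\<dots> \<le> s ^ Z n \<omega>"
        using Bernoulli_inequality[of "s - 1" "Z n \<omega>"] s by simp
      finally show ?thesis .
    qed
    then show "?b * indicator ?S \<omega> \<le> s ^ Z n \<omega> * indicator {\<omega> \<in> space M. Z n \<omega> > 0} \<omega>"
      using s by (auto simp: indicator_def)
  qed (use s in \<open>auto intro!: integrable_real_mult_indicator\<close>)
  also have "\<dots> = D n * (1 - exp (- y))"
    using pgf_Z_survival[OF s] by (simp add: pow)
  finally show ?thesis
    using D_pos[of n] unfolding log_cdf_eq by (simp add: field_simps)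
qed

lemma log_cdf_lower:
  assumes "y < x"
  shows "1 - exp (- y) \<le> log_cdf n x + exp (- exp ((x - y) / A n))"
proof (cases "0 \<le> y")
  \<comment> \<open>For negative y the number s would be negative, but then the left side is
    negative and the claim is trivial.\<close>
  case False
  then have "1 - exp (- y) \<le> 0" by simp
  also have "0 \<le> log_cdf n x + exp (- exp ((x - y) / A n))"
    by (simp add: cond_prob_def add_nonneg_nonneg)
  finally show ?thesis .
next
  case True
  define s where "s = 1 - exp (- (y / A n))"
  have s: "0 \<le> s" "s \<le> 1" and pow: "(1 - s) powr A n = exp (- y)"
    using A_pos[of n] True by (auto simp: s_def powr_def)
  let ?S = "{\<omega> \<in> space M. real (Z n \<omega>) \<le> exp (x / A n) \<and> Z n \<omega> > 0}"
  let ?P = "{\<omega> \<in> space M. Z n \<omega> > 0}"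
  let ?e = "exp (- exp ((x - y) / A n))"
  have "D n * (1 - exp (- y)) = (\<integral>\<omega>. s ^ Z n \<omega> * indicator ?P \<omega> \<partial>M)"
    using pgf_Z_survival[OF s] by (simp add: pow)
  also have "\<dots> \<le> (\<integral>\<omega>. indicator ?S \<omega> + ?e * indicator ?P \<omega> \<partial>M)"
  proof (rule integral_mono)
    fix \<omega>
    \<comment> \<open>Above the threshold, s is at most \<open>exp (- (1 - s))\<close>, and the
      exponent of the power is at least \<open>exp (x / A n)\<close>; this makes the power doubly
      exponentially small.\<close>
    have "s ^ Z n \<omega> \<le> ?e" if "\<not> real (Z n \<omega>) \<le> exp (x / A n)"
    proof -
      have "s \<le> exp (- (1 - s))"
        using exp_ge_add_one_self[of "- (1 - s)"] by simp
      then have "s ^ Z n \<omega> \<le> exp (- (1 - s)) ^ Z n \<omega>"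
        using s by (intro power_mono)
      also have "\<dots> = exp (- (real (Z n \<omega>) * (1 - s)))"
        by (simp add: algebra_simps flip: exp_of_nat_mult)
      also have "\<dots> \<le> exp (- (exp (x / A n) * (1 - s)))"
        using that s by (auto intro!: mult_right_mono)
      also have "exp (x / A n) * (1 - s) = exp ((x - y) / A n)"
        by (simp add: s_def diff_divide_distrib flip: exp_add)
      finally show ?thesis .
    qed
    then show "s ^ Z n \<omega> * indicator ?P \<omega> \<le> indicator ?S \<omega> + ?e * indicator ?P \<omega>"
      using s by (auto simp: indicator_def power_le_one intro: add_increasing2)
  qed (use s in \<open>auto intro!: integrable_real_mult_indicator\<close>)
  also have "\<dots> = prob ?S + ?e * D n"
    by (simp add: prob_Z_pos)
  finally show ?thesis
    using D_pos[of n] unfolding log_cdf_eq by (simp add: field_simps)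
qed

text \<open>The two bounds are used with y at distance \<open>sqrt (A n)\<close> from x: this
  distance tends to 0, while its quotient by \<open>A n\<close> tends to infinity, so y tends to x
  and the error terms vanish.\<close>

lemma log_cdf_tendsto:
  assumes "A_lim a = 0" "0 \<le> x"
  shows "(\<lambda>n. log_cdf n x) \<longlonglongrightarrow> 1 - exp (- x)"
proof (rule tendsto_sandwich)
  have A: "filterlim A (at_right 0) sequentially"
    using A_tendsto A_pos by (auto simp: assms(1) filterlim_at intro!: always_eventually less_imp_neq[symmetric])
  have sqrt: "sqrt (A n) > 0" for n using A_pos by simp
  show "\<forall>\<^sub>F n in sequentially.
      1 - exp (- (x - sqrt (A n))) - exp (- exp (sqrt (A n) / A n)) \<le> log_cdf n x"
    using log_cdf_lower[of "x - sqrt (A n)" x n for n] sqrt by (simp add: algebra_simps)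
  show "\<forall>\<^sub>F n in sequentially.
      log_cdf n x \<le> 1 - exp (- (x + sqrt (A n))) + exp (- (sqrt (A n) / A n))"
  proof (rule always_eventually, rule allI)
    fix n
    let ?e = "exp (- (sqrt (A n) / A n))"
    \<comment> \<open>Turns the multiplicative error in \<open>log_cdf_upper\<close> into an
      additive one.\<close>
    have "log_cdf n x \<le> 1"
      using finite_measure_mono[of "{\<omega> \<in> space M. real (Z n \<omega>) \<le> exp (x / A n) \<and> Z n \<omega> > 0}"
          "{\<omega> \<in> space M. Z n \<omega> > 0}"] D_pos[of n]
      unfolding log_cdf_eq prob_Z_pos by auto
    then have "log_cdf n x * ?e \<le> ?e" by simp
    then show "log_cdf n x \<le> 1 - exp (- (x + sqrt (A n))) + ?e"
      using log_cdf_upper[of x "x + sqrt (A n)" n] assms(2) sqrt[of n]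
      unfolding right_diff_distrib add_diff_cancel_left' mult_1_right by linarith
  qed
  have "((\<lambda>t. 1 - exp (- (x - sqrt t)) - exp (- exp (sqrt t / t))) \<longlongrightarrow> 1 - exp (- x)) (at_right 0)"
    by real_asymp
  from filterlim_compose[OF this A]
  show "(\<lambda>n. 1 - exp (- (x - sqrt (A n))) - exp (- exp (sqrt (A n) / A n))) \<longlonglongrightarrow> 1 - exp (- x)" .
  have "((\<lambda>t. 1 - exp (- (x + sqrt t)) + exp (- (sqrt t / t))) \<longlongrightarrow> 1 - exp (- x)) (at_right 0)"
    by real_asymp
  from filterlim_compose[OF this A]
  show "(\<lambda>n. 1 - exp (- (x + sqrt (A n))) + exp (- (sqrt (A n) / A n))) \<longlonglongrightarrow> 1 - exp (- x)" .
qed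

text \<open>With \<open>eln 0\<close> equal to minus infinity and \<open>A n\<close> positive,
  extinct paths always satisfy the inequality; they supply the summand
  \<open>1 - D n\<close>.\<close>

lemma prob_log_le:
  "\<P>(\<omega> in M. ereal (A n) * eln (Z n \<omega>) \<le> ereal x) = (1 - D n) + D n * log_cdf n x"
proof -
  let ?S = "{\<omega> \<in> space M. real (Z n \<omega>) \<le> exp (x / A n) \<and> Z n \<omega> > 0}"
  have "{\<omega> \<in> space M. ereal (A n) * eln (Z n \<omega>) \<le> ereal x} = {\<omega> \<in> space M. Z n \<omega> = 0} \<union> ?S"
    using A_pos[of n] by (auto simp: log_le_iff) (auto simp: eln_def)
  also have "prob \<dots> = prob {\<omega> \<in> space M. Z n \<omega> = 0} + prob ?S"
    by (rule finite_measure_Union) auto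
  finally show ?thesis
    unfolding log_cdf_eq using D_pos[of n] by (simp add: prob_Z_eq_0)
qed

lemma prob_log_le_tendsto:
  assumes "A_lim a = 0" "0 \<le> x"
  shows "(\<lambda>n. \<P>(\<omega> in M. ereal (A n) * eln (Z n \<omega>) \<le> ereal x)) \<longlonglongrightarrow> 1 - exp (- x) * D_lim a c"
proof -
  have "(\<lambda>n. (1 - D n) + D n * log_cdf n x) \<longlonglongrightarrow> (1 - D_lim a c) + D_lim a c * (1 - exp (- x))"
    by (intro tendsto_intros D_tendsto log_cdf_tendsto assms)
  then show ?thesis unfolding prob_log_le by (simp add: algebra_simps)
qed

section \<open>Positive limit of \<open>A n\<close>: generating functions and stabilisation of
  paths\<close>

lemma powr_A_tendsto:
  assumes "A_lim a > 0" "0 \<le> s" "s \<le> 1"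
  shows "(\<lambda>n. (1 - s) powr A n) \<longlonglongrightarrow> (1 - s) powr A_lim a"
  \<comment> \<open>At s = 1 the base is 0 and all the powers are 0; otherwise the base is positive
    and the power is continuous in its exponent.\<close>
  using assms by (cases "s = 1") (auto intro!: tendsto_intros A_tendsto)

lemma cond_pgf_tendsto:
  assumes "A_lim a > 0" "0 \<le> s" "s \<le> 1"
  shows "(\<lambda>n. cond_expectation_on M (\<lambda>\<omega>. s ^ Z n \<omega>) (\<lambda>\<omega>. Z n \<omega> > 0)) \<longlonglongrightarrow> 1 - (1 - s) powr A_lim a"
  using assms by (simp add: cond_pgf_Z tendsto_diff powr_A_tendsto)

text \<open>The left side is the derivative of the generating function at 0. The bound comes from
  its increment between 0 and a small s: the terms of degree at least 2 contribute at most
  \<open>s\<^sup>2\<close>, which after division by s leaves an error s.\<close>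

lemma pmf_1_lower:
  "a (Suc n) * (1 - c (Suc n)) powr (1 - a (Suc n)) \<le> pmf (p (Suc n)) 1"
proof (rule field_le_epsilon)
  fix e :: real assume "0 < e"
  \<comment> \<open>The cap 1/2 keeps s below 1; s at most e absorbs the final error.\<close>
  define s where "s = min e (1 / 2)"
  have s: "0 < s" "s < 1" "s \<le> e" using \<open>0 < e\<close> by (auto simp: s_def)
  define \<alpha> C q where "\<alpha> = a (Suc n)" and "C = (1 - c (Suc n)) powr (1 - \<alpha>)" and "q = pmf (p (Suc n))"
  have \<alpha>: "0 < \<alpha>" "\<alpha> < 1" and C: "0 \<le> C"
    using a_bounds by (auto simp: \<alpha>_def C_def)
  have pgf: "(\<lambda>j. q j * u ^ j) sums (1 - C * (1 - u) powr \<alpha>)" if "0 \<le> u" "u \<le> 1" for u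
    using offspring_pgf[of "Suc n"] that by (auto simp: has_pgf_def theta0_pgf_def \<alpha>_def C_def q_def)
  have q0: "q 0 = 1 - C"
    using pgf[of 0] powser_sums_zero[of q] by (auto dest: sums_unique2)
  \<comment> \<open>Majorant series: the terms of degree 0 and 1 are kept, and the rest is bounded
    by \<open>s\<^sup>2\<close> times the total mass, which is the generating function at 1.\<close>
  have "(\<lambda>j. (if j = 0 then q 0 else 0) + (if j = 1 then q 1 * s else 0) + q j * 1 ^ j * s\<^sup>2)
      sums (q 0 + q 1 * s + (1 - C * (1 - 1) powr \<alpha>) * s\<^sup>2)"
    by (intro sums_add sums_single sums_mult2 pgf) auto
  with pgf[of s] have "1 - C * (1 - s) powr \<alpha> \<le> q 0 + q 1 * s + (1 - C * (1 - 1) powr \<alpha>) * s\<^sup>2"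
  proof (rule sums_le[rotated])
    fix j
    have "q j * s ^ j \<le> q j * s\<^sup>2" if "j \<noteq> 0" "j \<noteq> 1"
      using that s by (intro mult_left_mono power_decreasing) (auto simp: q_def)
    then show "q j * s ^ j
        \<le> (if j = 0 then q 0 else 0) + (if j = 1 then q 1 * s else 0) + q j * 1 ^ j * s\<^sup>2"
      by (auto simp: q_def)
  qed (use s in auto)
  then have "C * (1 - (1 - s) powr \<alpha>) \<le> s * (q 1 + s)"
    by (simp add: q0 algebra_simps power2_eq_square)
  \<comment> \<open>Weighted arithmetic-geometric mean of 1 - s and 1, that is,
    \<open>(1 - s) powr \<alpha>\<close> is at most \<open>1 - \<alpha> * s\<close>.\<close>
  moreover have "(1 - s) powr \<alpha> * 1 powr (1 - \<alpha>) \<le> \<alpha> * (1 - s) + (1 - \<alpha>) * 1"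
    by (rule Youngs_inequality_0) (use \<alpha> s in auto)
  then have "C * (\<alpha> * s) \<le> C * (1 - (1 - s) powr \<alpha>)"
    using C by (intro mult_left_mono) (auto simp: algebra_simps)
  ultimately have "s * (\<alpha> * C) \<le> s * (q 1 + s)" by (simp add: algebra_simps)
  then have "\<alpha> * C \<le> q 1 + s" using s by simp
  then show "a (Suc n) * (1 - c (Suc n)) powr (1 - a (Suc n)) \<le> pmf (p (Suc n)) 1 + e"
    using s by (simp add: \<alpha>_def C_def q_def)
qed

text \<open>The probability is at most \<open>(1 - \<alpha>) * (1 - ln \<gamma>)\<close>, by
  \<open>pmf_1_lower\<close> and \<open>ln C\<close> at most \<open>C - 1\<close>. Multiplied by
  \<open>A n\<close> this bound is exactly the decrement of \<open>A\<close> plus that of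
  \<open>ln D\<close>, so it telescopes; both limits are finite because the limit of
  \<open>D\<close> is positive. Division by \<open>A_lim a\<close>, a positive lower bound of
  \<open>A n\<close>, finishes.\<close>

lemma summable_prob_X_neq_1:
  assumes pos: "A_lim a > 0" "D_lim a c > 0" and i: "i \<ge> 1"
  shows "summable (\<lambda>n. prob {\<omega> \<in> space M. X (Suc n) i \<omega> \<noteq> 1})"
proof -
  have "summable (\<lambda>n. (A n - A (Suc n)) + (ln (D n) - ln (D (Suc n))))"
    using pos by (intro summable_add telescope_summable'[OF A_tendsto]
        telescope_summable'[OF tendsto_ln[OF D_tendsto]]) auto
  then have "summable (\<lambda>n. ((A n - A (Suc n)) + (ln (D n) - ln (D (Suc n)))) / A_lim a)"
    by (rule summable_divide)
  then show ?thesis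
  proof (rule summable_comparison_test'[where N=0])
    fix n
    define \<alpha> \<gamma> C where "\<alpha> = a (Suc n)" and "\<gamma> = 1 - c (Suc n)" and "C = \<gamma> powr (1 - \<alpha>)"
    have \<alpha>: "0 < \<alpha>" "\<alpha> < 1" and \<gamma>: "0 < \<gamma>" "\<gamma> \<le> 1"
      using a_bounds[of n] c_bounds[of n] by (auto simp: \<alpha>_def \<gamma>_def)
    then have C: "0 < C" "C \<le> 1" by (auto simp: C_def intro!: powr_le1)
    have "prob {\<omega> \<in> space M. X (Suc n) i \<omega> \<noteq> 1} = 1 - pmf (p (Suc n)) 1"
      using prob_neg[of "\<lambda>\<omega>. X (Suc n) i \<omega> = 1"] i by (simp add: offspring_law)
    also have "\<dots> \<le> 1 - \<alpha> * C"
      using pmf_1_lower[of n] by (simp add: \<alpha>_def C_def \<gamma>_def)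
    also have "\<dots> \<le> (1 - \<alpha>) + (1 - C)"
      using mult_nonneg_nonneg[of "1 - \<alpha>" "1 - C"] \<alpha> C by (simp add: algebra_simps)
    also have "1 - C \<le> - ((1 - \<alpha>) * ln \<gamma>)"
      using ln_le_minus_one[of C] C \<gamma> by (simp add: C_def ln_powr)
    finally have le: "prob {\<omega> \<in> space M. X (Suc n) i \<omega> \<noteq> 1} \<le> (1 - \<alpha>) * (1 - ln \<gamma>)"
      by (simp add: algebra_simps)
    have "A_lim a * prob {\<omega> \<in> space M. X (Suc n) i \<omega> \<noteq> 1} \<le> A n * ((1 - \<alpha>) * (1 - ln \<gamma>))"
      by (rule mult_mono) (use A_lim_le le A_pos[of n] in auto)
    also have "\<dots> = (A n - A (Suc n)) + (ln (D n) - ln (D (Suc n)))"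
      using D_pos[of n] \<gamma> by (simp add: D_Suc A_Suc ln_mult ln_powr \<alpha>_def \<gamma>_def algebra_simps)
    finally show "norm (prob {\<omega> \<in> space M. X (Suc n) i \<omega> \<noteq> 1})
        \<le> ((A n - A (Suc n)) + (ln (D n) - ln (D (Suc n)))) / A_lim a"
      using pos by (simp add: field_simps)
  qed
qed

text \<open>Borel-Cantelli for each position i, then a countable intersection. The generation from
  which the count is 1 may depend on i.\<close>

lemma AE_X_eventually_1:
  assumes "A_lim a > 0" "D_lim a c > 0"
  shows "AE \<omega> in M. \<forall>i\<in>{1..}. \<forall>\<^sub>F n in sequentially. X (Suc n) i \<omega> = 1"
proof (subst AE_ball_countable)
  show "\<forall>i\<in>{1..}. AE \<omega> in M. \<forall>\<^sub>F n in sequentially. X (Suc n) i \<omega> = 1"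
  proof
    fix i :: nat assume i: "i \<in> {1..}"
    have "AE \<omega> in M. \<forall>\<^sub>F n in sequentially. \<omega> \<in> space M - {\<omega> \<in> space M. X (Suc n) i \<omega> \<noteq> 1}"
    proof (rule borel_cantelli_AE1)
      have [measurable]: "X (Suc n) i \<in> measurable M (count_space UNIV)" for n
        using i by (intro measurable_X) auto
      show "{\<omega> \<in> space M. X (Suc n) i \<omega> \<noteq> 1} \<in> events" for n by measurable
      show "summable (\<lambda>n. prob {\<omega> \<in> space M. X (Suc n) i \<omega> \<noteq> 1})"
        using i by (intro summable_prob_X_neq_1 assms) auto
    qed (simp add: less_top[symmetric])
    then show "AE \<omega> in M. \<forall>\<^sub>F n in sequentially. X (Suc n) i \<omega> = 1"
      by eventually_elim (auto elim: eventually_mono)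
  qed
qed simp

text \<open>A path that does not tend to infinity is below some K infinitely often. From some
  generation on, the first K individuals have exactly one child each, so at the next visit below K
  the path freezes.\<close>

lemma eventually_constant_or_unbounded:
  assumes \<omega>: "\<omega> \<in> space M" and X: "\<forall>i\<in>{1..}. \<forall>\<^sub>F n in sequentially. X (Suc n) i \<omega> = 1"
  shows "(\<exists>k. \<forall>\<^sub>F n in sequentially. Z n \<omega> = k) \<or> filterlim (\<lambda>n. Z n \<omega>) at_top sequentially"
proof (rule disjCI)
  assume "\<not> filterlim (\<lambda>n. Z n \<omega>) at_top sequentially"
  then obtain K where K: "\<not> (\<forall>\<^sub>F n in sequentially. K \<le> Z n \<omega>)"
    by (auto simp: filterlim_at_top)
  have "\<forall>\<^sub>F n in sequentially. \<forall>i\<in>{1..K}. X (Suc n) i \<omega> = 1"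
    by (rule eventually_ball_finite) (use X in auto)
  then obtain N where N: "\<And>n i. n \<ge> N \<Longrightarrow> i \<in> {1..K} \<Longrightarrow> X (Suc n) i \<omega> = 1"
    unfolding eventually_sequentially by blast
  obtain n where n: "n \<ge> N" "Z n \<omega> \<le> K"
    using K by (auto simp: eventually_sequentially not_le intro: less_imp_le)
  have "Z m \<omega> = Z n \<omega>" if "m \<ge> n" for m
    using that
  proof (induction m rule: dec_induct)
    case (step m)
    have "Z (Suc m) \<omega> = (\<Sum>i = 1..Z m \<omega>. X (Suc m) i \<omega>)"
      using branching[of "Suc m" \<omega>] \<omega> by simp
    also have "\<dots> = (\<Sum>i = 1..Z m \<omega>. 1)"
      by (intro sum.cong N) (use step n in auto)
    finally show ?case using step by simp
  qed simp
  then show "\<exists>k. \<forall>\<^sub>F n in sequentially. Z n \<omega> = k"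
    by (auto simp: eventually_sequentially)
qed

section \<open>The limit variable: existence, generating function and infinite mean\<close>

text \<open>Meaningful only where \<open>Z\<close> converges, that is, on \<open>settled\<close> below; elsewhere \<open>lim\<close> is a junk value.\<close>

definition Z_inf :: "'w \<Rightarrow> nat" where
  "Z_inf \<omega> = nat \<lfloor>lim (\<lambda>n. real (Z n \<omega>))\<rfloor>"

lemma measurable_Z_inf [measurable]: "Z_inf \<in> measurable M (count_space UNIV)"
proof -
  have [measurable]: "(\<lambda>\<omega>. lim (\<lambda>n. real (Z n \<omega>))) \<in> borel_measurable M"
    by (rule borel_measurable_lim_metric) measurable
  show ?thesis unfolding Z_inf_def by measurable
qed

lemma Z_inf_eqI:
  assumes "\<forall>\<^sub>F n in sequentially. Z n \<omega> = k"
  shows "Z_inf \<omega> = k" "(\<lambda>n. real (Z n \<omega>)) \<longlonglongrightarrow> real k"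
proof -
  show lim: "(\<lambda>n. real (Z n \<omega>)) \<longlonglongrightarrow> real k"
    by (rule tendsto_eventually) (use assms in eventually_elim, simp)
  show "Z_inf \<omega> = k"
    unfolding Z_inf_def limI[OF lim] by simp
qed

definition settled :: "'w set" where
  "settled = {\<omega> \<in> space M. \<exists>k. \<forall>\<^sub>F n in sequentially. Z n \<omega> = k}"

lemma settled_event [measurable]: "settled \<in> events"
  unfolding settled_def eventually_sequentially by measurable

text \<open>For s < 1, \<open>s ^ Z n\<close> tends to 0 on paths going to infinity, so in the limit
  only settled paths contribute. At this stage some mass may still be lost at infinity.\<close>

lemma defective_pgf_Z_inf:
  assumes pos: "A_lim a > 0" "D_lim a c > 0" and s: "0 \<le> s" "s < 1"
  shows "(\<integral>\<omega>. s ^ Z_inf \<omega> * indicator settled \<omega> \<partial>M) = 1 - D_lim a c * (1 - s) powr A_lim a"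
proof (rule LIMSEQ_unique)
  show "(\<lambda>n. \<integral>\<omega>. s ^ Z n \<omega> \<partial>M) \<longlonglongrightarrow> 1 - D_lim a c * (1 - s) powr A_lim a"
    using s by (simp add: pgf_Z) (intro tendsto_intros D_tendsto powr_A_tendsto pos; simp)
  show "(\<lambda>n. \<integral>\<omega>. s ^ Z n \<omega> \<partial>M) \<longlonglongrightarrow> (\<integral>\<omega>. s ^ Z_inf \<omega> * indicator settled \<omega> \<partial>M)"
  proof (rule integral_dominated_convergence[where w="\<lambda>_. 1"])
    show "AE \<omega> in M. (\<lambda>n. s ^ Z n \<omega>) \<longlonglongrightarrow> s ^ Z_inf \<omega> * indicator settled \<omega>"
      using AE_X_eventually_1[OF pos] AE_space
    proof eventually_elim
      case (elim \<omega>)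
      show ?case
      proof (cases "\<omega> \<in> settled")
        case True
        then obtain k where k: "\<forall>\<^sub>F n in sequentially. Z n \<omega> = k"
          by (auto simp: settled_def)
        have "\<forall>\<^sub>F n in sequentially. s ^ Z n \<omega> = s ^ Z_inf \<omega> * indicator settled \<omega>"
          using k by eventually_elim (simp add: Z_inf_eqI(1)[OF k] True)
        then show ?thesis by (rule tendsto_eventually)
      next
        case False
        then have "filterlim (\<lambda>n. Z n \<omega>) at_top sequentially"
          using eventually_constant_or_unbounded[OF elim(2,1)] elim(2) by (auto simp: settled_def)
        then have "(\<lambda>n. s ^ Z n \<omega>) \<longlonglongrightarrow> 0"
          by (rule filterlim_compose[OF LIMSEQ_power_zero, rotated]) (use s in auto)
        then show ?thesis using False by simp
      qed
    qed
    show "AE \<omega> in M. norm (s ^ Z n \<omega>) \<le> 1" for n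
      using s by (auto intro!: AE_I2 power_le_one)
  qed auto
qed

text \<open>Take s = 1 - t with t decreasing to 0. The defective generating function is at most
  \<open>prob settled\<close>, and its explicit form tends to 1 because \<open>A_lim a\<close> is
  positive, so no mass escapes.\<close>

lemma AE_settled:
  assumes pos: "A_lim a > 0" "D_lim a c > 0"
  shows "AE \<omega> in M. \<omega> \<in> settled"
proof -
  have "1 \<le> prob settled"
  proof (rule tendsto_upperbound)
    show "((\<lambda>t. 1 - D_lim a c * t powr A_lim a) \<longlongrightarrow> 1) (at_right 0)"
      using tendsto_diff[OF tendsto_const tendsto_mult_right_zero[OF powr_tendsto_0_at_right[OF pos(1)]]]
      by simp
    have "1 - D_lim a c * t powr A_lim a \<le> prob settled" if t: "0 < t" "t < 1" for t
    proof -
      have "1 - D_lim a c * t powr A_lim a = (\<integral>\<omega>. (1 - t) ^ Z_inf \<omega> * indicator settled \<omega> \<partial>M)"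
        using defective_pgf_Z_inf[OF pos, of "1 - t"] t by simp
      also have "\<dots> \<le> (\<integral>\<omega>. indicator settled \<omega> \<partial>M)"
        by (rule integral_mono)
          (use t in \<open>auto simp: indicator_def power_le_one
            intro!: integrable_real_mult_indicator integrable_const_bound[where B=1]\<close>)
      finally show ?thesis by simp
    qed
    then show "\<forall>\<^sub>F t in at_right 0. 1 - D_lim a c * t powr A_lim a \<le> prob settled"
      by (auto simp: eventually_at_right_field intro!: exI[of _ 1])
  qed simp
  then have "prob settled = 1" by (simp add: antisym)
  then show ?thesis by (simp add: prob_eq_1)
qed

lemma AE_Z_tendsto:
  assumes "A_lim a > 0" "D_lim a c > 0"
  shows "AE \<omega> in M. (\<lambda>n. real (Z n \<omega>)) \<longlonglongrightarrow> real (Z_inf \<omega>)"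
  using AE_settled[OF assms]
  by eventually_elim (use Z_inf_eqI in \<open>auto simp: settled_def\<close>)

lemma pgf_Z_inf:
  assumes pos: "A_lim a > 0" "D_lim a c > 0" and s: "0 \<le> s" "s \<le> 1"
  shows "(\<integral>\<omega>. s ^ Z_inf \<omega> \<partial>M) = 1 - (1 - s) powr A_lim a * D_lim a c"
proof (cases "s = 1")
  case True
  then show ?thesis by (simp add: prob_space)
next
  case False
  have "(\<integral>\<omega>. s ^ Z_inf \<omega> \<partial>M) = (\<integral>\<omega>. s ^ Z_inf \<omega> * indicator settled \<omega> \<partial>M)"
    by (rule integral_cong_AE) (use AE_settled[OF pos] in auto)
  then show ?thesis
    using defective_pgf_Z_inf[OF pos, of s] s False by (simp add: mult.commute)
qed

text \<open>If the mean m were finite, then \<open>1 - (1 - t) ^ Z_inf\<close> being at most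
  \<open>t * Z_inf\<close> would give \<open>D_lim a c\<close> at most
  \<open>m * t powr (1 - A_lim a)\<close>. Since \<open>A_lim a\<close> is below 1, letting t tend
  to 0 contradicts positivity of \<open>D_lim a c\<close>.\<close>

lemma Z_inf_mean:
  assumes pos: "A_lim a > 0" "D_lim a c > 0"
  shows "(\<integral>\<^sup>+\<omega>. ennreal (real (Z_inf \<omega>)) \<partial>M) = \<infinity>"
proof (rule ccontr)
  assume "(\<integral>\<^sup>+\<omega>. ennreal (real (Z_inf \<omega>)) \<partial>M) \<noteq> \<infinity>"
  then have int: "integrable M (\<lambda>\<omega>. real (Z_inf \<omega>))"
    by (intro integrableI_nonneg) (auto simp: less_top)
  define m where "m = (\<integral>\<omega>. real (Z_inf \<omega>) \<partial>M)"
  have bound: "D_lim a c \<le> m * t powr (1 - A_lim a)" if t: "0 < t" "t < 1" for t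
  proof -
    have int': "integrable M (\<lambda>\<omega>. (1 - t) ^ Z_inf \<omega>)"
      by (intro integrable_const_bound[where B=1]) (use t in \<open>auto intro!: AE_I2 power_le_one\<close>)
    have "t powr A_lim a * D_lim a c = (\<integral>\<omega>. 1 - (1 - t) ^ Z_inf \<omega> \<partial>M)"
      using pgf_Z_inf[OF pos, of "1 - t"] t int' by (simp add: prob_space)
    also have "\<dots> \<le> (\<integral>\<omega>. t * real (Z_inf \<omega>) \<partial>M)"
    proof (rule integral_mono)
      show "1 - (1 - t) ^ Z_inf \<omega> \<le> t * real (Z_inf \<omega>)" for \<omega>
        using Bernoulli_inequality[of "- t" "Z_inf \<omega>"] t by (simp add: mult.commute)
    qed (use int int' in auto)
    also have "\<dots> = t powr A_lim a * (m * t powr (1 - A_lim a))"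
      using t by (simp add: m_def mult.left_commute flip: powr_add)
    finally show ?thesis using t by simp
  qed
  have "D_lim a c \<le> 0"
  proof (rule tendsto_lowerbound)
    show "((\<lambda>t. m * t powr (1 - A_lim a)) \<longlongrightarrow> 0) (at_right 0)"
      using A_lim_less_1 by (intro tendsto_mult_right_zero powr_tendsto_0_at_right) simp
    show "\<forall>\<^sub>F t in at_right 0. D_lim a c \<le> m * t powr (1 - A_lim a)"
      using bound by (auto simp: eventually_at_right_field intro!: exI[of _ 1])
  qed simp
  then show False using pos by simp
qed

end

text \<open>The convergence statements accompany the values written with \<open>lim\<close>, which
  is arbitrary for divergent sequences. The infinite mean is a nonnegative integral, since the
  Bochner integral of a non-integrable function is 0.\<close>

theorem theorem6:
  fixes M :: "'w measure"
    and p :: "nat \<Rightarrow> nat pmf"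
    and X :: "nat \<Rightarrow> nat \<Rightarrow> 'w \<Rightarrow> nat"
    and Z :: "nat \<Rightarrow> 'w \<Rightarrow> nat"
    and a c :: "nat \<Rightarrow> real"
  assumes "gw_theta0 M p X Z a c"
  shows
    "(\<forall>n. \<P>(\<omega> in M. Z n \<omega> > 0) = D_seq a c n)
     \<and> A_seq a \<longlonglongrightarrow> A_lim a \<and> 0 \<le> A_lim a \<and> A_lim a < 1
     \<and> D_seq a c \<longlonglongrightarrow> D_lim a c \<and> 0 \<le> D_lim a c \<and> D_lim a c \<le> 1
     \<and> (\<lambda>n. \<P>(\<omega> in M. Z n \<omega> = 0)) \<longlonglongrightarrow> extinction_prob M Z
     \<and> extinction_prob M Z = 1 - D_lim a c
     \<and> (A_lim a = 0 \<and> D_lim a c = 0 \<longrightarrow>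
          extinction_prob M Z = 1
          \<and> (\<forall>x\<ge>0. (\<lambda>n. \<P>(\<omega> in M. ereal (A_seq a n) * eln (Z n \<omega>) \<le> ereal x \<bar> Z n \<omega> > 0))
                      \<longlonglongrightarrow> 1 - exp (- x)))
     \<and> (A_lim a = 0 \<and> D_lim a c > 0 \<longrightarrow>
          extinction_prob M Z < 1
          \<and> (\<forall>x\<ge>0. (\<lambda>n. \<P>(\<omega> in M. ereal (A_seq a n) * eln (Z n \<omega>) \<le> ereal x))
                      \<longlonglongrightarrow> 1 - exp (- x) * D_lim a c))
     \<and> (A_lim a \<in> {0<..<1} \<and> D_lim a c = 0 \<longrightarrow>
          extinction_prob M Z = 1
          \<and> (\<forall>s\<in>{0..1}. (\<lambda>n. cond_expectation_on M (\<lambda>\<omega>. s ^ Z n \<omega>) (\<lambda>\<omega>. Z n \<omega> > 0))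
                      \<longlonglongrightarrow> 1 - (1 - s) powr A_lim a))
     \<and> (A_lim a \<in> {0<..<1} \<and> D_lim a c > 0 \<longrightarrow>
          extinction_prob M Z < 1
          \<and> (\<exists>Zinf :: 'w \<Rightarrow> nat.
                Zinf \<in> measurable M (count_space UNIV)
                \<and> (AE \<omega> in M. (\<lambda>n. real (Z n \<omega>)) \<longlonglongrightarrow> real (Zinf \<omega>))
                \<and> (\<integral>\<^sup>+ \<omega>. ennreal (real (Zinf \<omega>)) \<partial>M) = \<infinity>
                \<and> (\<forall>s\<in>{0..1}. (\<integral>\<omega>. s ^ Zinf \<omega> \<partial>M)
                      = 1 - (1 - s) powr A_lim a * D_lim a c)))"
proof -
  interpret gw_theta0 M p X Z a c by (fact assms)
  have D: "D_lim a c \<le> 1" using D_lim_le[of 0] by simp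
  show ?thesis
  proof (intro conjI impI)
    show "\<exists>Zinf :: 'w \<Rightarrow> nat.
        Zinf \<in> measurable M (count_space UNIV)
        \<and> (AE \<omega> in M. (\<lambda>n. real (Z n \<omega>)) \<longlonglongrightarrow> real (Zinf \<omega>))
        \<and> (\<integral>\<^sup>+ \<omega>. ennreal (real (Zinf \<omega>)) \<partial>M) = \<infinity>
        \<and> (\<forall>s\<in>{0..1}. (\<integral>\<omega>. s ^ Zinf \<omega> \<partial>M) = 1 - (1 - s) powr A_lim a * D_lim a c)"
      if "A_lim a \<in> {0<..<1} \<and> D_lim a c > 0"
      using that AE_Z_tendsto pgf_Z_inf Z_inf_mean by (intro exI[of _ Z_inf]) auto
  qed (use prob_Z_pos A_tendsto A_lim_nonneg A_lim_less_1 D_tendsto D_lim_nonneg D extinction_tendsto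
      log_cdf_tendsto prob_log_le_tendsto cond_pgf_tendsto in \<open>auto simp: extinction_prob_eq\<close>)
qed

end
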